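(* Let $F$ be an algebraically closed field of characteristic different from $2$. Every simple commutative $3$-dimensional algebra over $F$ (not necessarily unital) with a nil-basis has a standard isotope that is isomorphic to the algebra $C(-2)$.
   Context: An algebra over $F$ is a vector space with a bilinear multiplication (not necessarily associative). An algebra is simple if its multiplication is nonzero and it has no ideals other than $0$ and itself. A nonzero element $x$ is a nil-element of index $2$ if $x^2=0$; a nil-basis of an algebra is a basis consisting of nil-elements of index $2$. For invertible linear operators $f,g$ on the space of an algebra $(A,\cdot)$, the principal isotope $A^{(f,g)}$ is the same vector space with the multiplication $u\ast v=f(u)\cdot g(v)$. The isotope $A^{(f,g)}$ is called standard if $f$ and $g$ are proportional (i.e. $g=\lambda f$ for some nonzero $\lambda\in F$). $C(-2)$ is the unital commutative algebra with basis $1,x,y$, where $1$ is the identity element, and $x^2=y^2=0$, $xy=yx=-2(1+x+y)$. *)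

theory Defs
  imports "HOL-Analysis.Cartesian_Space" "HOL-Computational_Algebra.Polynomial"
begin

text \<open>As with \<^locale>\<open>vector_space\<close>, the whole type \<open>'a\<close> is the carrier.\<close>

locale nonassoc_algebra = vector_space scl
  for scl :: "'f::field \<Rightarrow> 'a::ab_group_add \<Rightarrow> 'a" +
  fixes mul :: "'a \<Rightarrow> 'a \<Rightarrow> 'a"
  assumes mul_add_left: "mul (u + v) w = mul u w + mul v w"
    and mul_add_right: "mul u (v + w) = mul u v + mul u w"
    and mul_scale_left: "mul (scl c u) v = scl c (mul u v)"
    and mul_scale_right: "mul u (scl c v) = scl c (mul u v)"
begin

definition ideal :: "'a set \<Rightarrow> bool" where
  "ideal I \<longleftrightarrow> subspace I \<and> (\<forall>a. \<forall>x\<in>I. mul a x \<in> I \<and> mul x a \<in> I)"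

definition simple :: bool where
  "simple \<longleftrightarrow> (\<exists>u v. mul u v \<noteq> 0) \<and> (\<forall>I. ideal I \<longrightarrow> I = {0} \<or> I = UNIV)"

definition commutative :: bool where
  "commutative \<longleftrightarrow> (\<forall>u v. mul u v = mul v u)"

definition nil_element2 :: "'a \<Rightarrow> bool" where
  "nil_element2 x \<longleftrightarrow> x \<noteq> 0 \<and> mul x x = 0"

definition nil_basis :: "'a set \<Rightarrow> bool" where
  "nil_basis B \<longleftrightarrow> independent B \<and> span B = UNIV \<and> (\<forall>x\<in>B. nil_element2 x)"

end

definition invertible_operator :: "('f::field \<Rightarrow> 'a::ab_group_add \<Rightarrow> 'a) \<Rightarrow> ('a \<Rightarrow> 'a) \<Rightarrow> bool" where
  "invertible_operator scl f \<longleftrightarrow> Vector_Spaces.linear scl scl f \<and> bij f"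

definition proportional ::
    "('f::field \<Rightarrow> 'a::ab_group_add \<Rightarrow> 'a) \<Rightarrow> ('a \<Rightarrow> 'a) \<Rightarrow> ('a \<Rightarrow> 'a) \<Rightarrow> bool" where
  "proportional scl f g \<longleftrightarrow> (\<exists>c. c \<noteq> 0 \<and> (\<forall>v. g v = scl c (f v)))"

text \<open>The multiplication of the principal isotope \<open>A\<^bsup>(f,g)\<^esup>\<close>; the vector space is that of \<open>A\<close>.\<close>

definition isotope_mult :: "('a \<Rightarrow> 'a \<Rightarrow> 'a) \<Rightarrow> ('a \<Rightarrow> 'a) \<Rightarrow> ('a \<Rightarrow> 'a) \<Rightarrow> 'a \<Rightarrow> 'a \<Rightarrow> 'a" where
  "isotope_mult mul f g u v = mul (f u) (g v)"

definition algebra_isomorphic ::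
    "('f::field \<Rightarrow> 'a::ab_group_add \<Rightarrow> 'a) \<Rightarrow> ('a \<Rightarrow> 'a \<Rightarrow> 'a) \<Rightarrow>
     ('f \<Rightarrow> 'b::ab_group_add \<Rightarrow> 'b) \<Rightarrow> ('b \<Rightarrow> 'b \<Rightarrow> 'b) \<Rightarrow> bool" where
  "algebra_isomorphic s1 m1 s2 m2 \<longleftrightarrow>
     (\<exists>\<phi>. Vector_Spaces.linear s1 s2 \<phi> \<and> bij \<phi> \<and> (\<forall>u v. \<phi> (m1 u v) = m2 (\<phi> u) (\<phi> v)))"

text \<open>
  The algebra \<open>C(-2)\<close> on \<open>F\<^sup>3\<close>. The coordinates 1, 2, 3 belong to the basis \<open>1, x, y\<close>.
  The product is the bilinear extension of \<open>1\<close> being the identity, \<open>x\<^sup>2 = y\<^sup>2 = 0\<close> and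
  \<open>xy = yx = -2(1 + x + y)\<close>; the latter contributes the scalar \<open>s\<close> to all three coordinates.
\<close>

definition C_minus2_mult :: "'f::field ^ 3 \<Rightarrow> 'f ^ 3 \<Rightarrow> 'f ^ 3" where
  "C_minus2_mult u v =
     (let s = - 2 * (u$2 * v$3 + u$3 * v$2) in
      vector [u$1 * v$1 + s, u$1 * v$2 + u$2 * v$1 + s, u$1 * v$3 + u$3 * v$1 + s])"

lemma C_minus2_table:
  fixes e x y u :: "'f::field ^ 3"
  defines "e \<equiv> axis 1 1" and "x \<equiv> axis 2 1" and "y \<equiv> axis 3 1"
  shows "C_minus2_mult e u = u" "C_minus2_mult u e = u"
    and "C_minus2_mult x x = 0" "C_minus2_mult y y = 0"
    and "C_minus2_mult x y = (- 2) *s (e + x + y)" "C_minus2_mult y x = (- 2) *s (e + x + y)"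
  by (simp_all add: assms C_minus2_mult_def Let_def vec_eq_iff forall_3 axis_def)

lemma nonassoc_algebra_C_minus2:
  "nonassoc_algebra ((*s) :: 'f::field \<Rightarrow> 'f ^ 3 \<Rightarrow> 'f ^ 3) C_minus2_mult"
  by unfold_locales
    (simp_all add: C_minus2_mult_def Let_def vec_eq_iff forall_3 algebra_simps)

lemma (in nonassoc_algebra) nonassoc_algebra_isotope:
  assumes "invertible_operator scl f" "invertible_operator scl g"
  shows "nonassoc_algebra scl (isotope_mult mul f g)"
proof -
  interpret f: Vector_Spaces.linear scl scl f
    using assms by (simp add: invertible_operator_def)
  interpret g: Vector_Spaces.linear scl scl g
    using assms by (simp add: invertible_operator_def)
  show ?thesis
    by unfold_locales
      (simp_all add: isotope_mult_def f.add g.add f.scale g.scale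
        mul_add_left mul_add_right mul_scale_left mul_scale_right)
qed

end

theory Submission
  imports Defs
begin

text \<open>
  Let \<open>x, y, z\<close> be a nil-basis of a commutative algebra \<open>A\<close> of dimension 3. All products
  of the algebra are combinations of \<open>yz\<close>, \<open>xz\<close>, \<open>xy\<close>, because the squares of the basis
  elements vanish. If the algebra is simple, the subspace of all such combinations is a nonzero
  ideal, hence the whole algebra, so that the three products form a second basis.

  Dimension 3 is the one in which a nil-basis and its pairwise products are equally many, and this
  makes any two commutative algebras of this kind standard isotopes of each other up to
  isomorphism. Let \<open>x', y', z'\<close> be such a nil-basis in a second algebra \<open>A'\<close>. Let the linear
  bijection \<open>\<phi>\<close> from \<open>A\<close> to \<open>A'\<close> take the products of the first basis to the corresponding
  products of the second one, and let \<open>\<psi>\<close> from \<open>A'\<close> to \<open>A\<close> take \<open>x', y', z'\<close> to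
  \<open>x, y, z\<close>. Both sides of \<open>\<phi> (\<psi> s \<cdot> \<psi> t) = s \<cdot> t\<close> are bilinear and agree on the
  basis \<open>x', y', z'\<close>. With \<open>s = \<phi> u\<close> and \<open>t = \<phi> v\<close> the identity says that \<open>\<phi>\<close> is
  an isomorphism from the isotope given by \<open>f = g = \<psi> \<circ> \<phi>\<close> onto \<open>A'\<close>
  (\<open>isotope_isomorphic_if_nil_spanning_triples\<close>).

  The algebra \<open>C(-2)\<close> is of this kind if 2 is invertible: besides \<open>x\<close> and \<open>y\<close>, the
  element \<open>2 + x + y\<close> squares to zero.
\<close>

lemma (in vector_space) spanning_triple_independent:
  assumes "dim UNIV = 3" and "span {x, y, z} = UNIV"
  shows "independent {x, y, z}" and "distinct [x, y, z]"
proof -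
  obtain B where B: "B \<subseteq> {x, y, z}" "independent B" "{x, y, z} \<subseteq> span B"
    using maximal_independent_subset by blast
  have "span B = span UNIV"
    using assms(2) B by (metis span_UNIV span_minimal subspace_span top.extremum_uniqueI)
  then have "card B = 3"
    using dim_eq_card B(2) assms(1) by metis
  moreover have "card {x, y, z} \<le> 3"
    by (simp add: card_insert_if)
  ultimately have "B = {x, y, z}" and "card {x, y, z} = 3"
    using B(1) by (metis card_seteq finite.emptyI finite.insertI)
      (metis B(1) \<open>card B = 3\<close> \<open>card {x, y, z} \<le> 3\<close> card_mono finite.emptyI finite.insertI le_antisym)
  then show "independent {x, y, z}" and "distinct [x, y, z]"
    using B(2) by (auto simp: card_insert_if split: if_splits)
qed

lemma (in vector_space_pair) linear_bijection_between_spanning_triples: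
  assumes "vs1.dim UNIV = 3" and "vs1.span {x, y, z} = UNIV"
    and "vs2.dim UNIV = 3" and "vs2.span {x', y', z'} = UNIV"
  obtains \<phi> where "Vector_Spaces.linear s1 s2 \<phi>" and "bij \<phi>"
    and "\<phi> x = x'" and "\<phi> y = y'" and "\<phi> z = z'"
proof -
  interpret p21: vector_space_pair s2 s1 ..
  interpret p11: vector_space_pair s1 s1 ..
  interpret p22: vector_space_pair s2 s2 ..
  note ind1 = vs1.spanning_triple_independent[OF assms(1,2)]
  note ind2 = vs2.spanning_triple_independent[OF assms(3,4)]
  let ?h = "\<lambda>b. if b = x then x' else if b = y then y' else z'"
  let ?k = "\<lambda>b. if b = x' then x else if b = y' then y else z"
  obtain \<phi> where \<phi>: "Vector_Spaces.linear s1 s2 \<phi>" "\<phi> x = x'" "\<phi> y = y'" "\<phi> z = z'"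
    using linear_construct[OF ind1(1), of ?h] construct_basis[OF ind1(1), of _ ?h] ind1(2) that
    by auto
  obtain \<theta> where \<theta>: "Vector_Spaces.linear s2 s1 \<theta>" "\<theta> x' = x" "\<theta> y' = y" "\<theta> z' = z"
    using p21.linear_construct[OF ind2(1), of ?k] p21.construct_basis[OF ind2(1), of _ ?k] ind2(2)
    by auto
  have "\<theta> \<circ> \<phi> = id"
  proof
    show "(\<theta> \<circ> \<phi>) v = id v" for v
      by (rule p11.linear_eq_on[OF Vector_Spaces.linear_compose[OF \<phi>(1) \<theta>(1)] vs1.linear_id,
            where B = "{x, y, z}"]) (use \<phi> \<theta> assms(2) in auto)
  qed
  moreover have "\<phi> \<circ> \<theta> = id"
  proof
    show "(\<phi> \<circ> \<theta>) v = id v" for v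
      by (rule p22.linear_eq_on[OF Vector_Spaces.linear_compose[OF \<theta>(1) \<phi>(1)] vs2.linear_id,
            where B = "{x', y', z'}"]) (use \<phi> \<theta> assms(4) in auto)
  qed
  ultimately have "bij \<phi>"
    by (rule o_bij)
  with \<phi> show thesis by (intro that)
qed

lemma (in vector_space_pair) bilinear_eqI_on_spanning_set:
  assumes "\<And>t. Vector_Spaces.linear s1 s2 (\<lambda>s. p s t)" "\<And>s. Vector_Spaces.linear s1 s2 (p s)"
    and "\<And>t. Vector_Spaces.linear s1 s2 (\<lambda>s. q s t)" "\<And>s. Vector_Spaces.linear s1 s2 (q s)"
    and "vs1.span B = UNIV"
    and "\<And>a b. a \<in> B \<Longrightarrow> b \<in> B \<Longrightarrow> p a b = q a b"
  shows "p s t = q s t"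
proof -
  have "p a t = q a t" if "a \<in> B" for a
    using linear_eq_on[OF assms(2) assms(4), of t B a a] assms(5,6) that by auto
  then show ?thesis
    using linear_eq_on[OF assms(1) assms(3), of s B t t] assms(5) by auto
qed

context nonassoc_algebra
begin

text \<open>
  The isotopy argument works for the commutative algebras of dimension 3 with such a triple.
  Spanning is required in place of independence because it is what simplicity gives for the
  products and what is easily checked in \<open>C(-2)\<close>; in dimension 3 both triples are then bases.
\<close>

definition nil_spanning_triple :: "'a \<Rightarrow> 'a \<Rightarrow> 'a \<Rightarrow> bool" where
  "nil_spanning_triple x y z \<longleftrightarrow>
     span {x, y, z} = UNIV \<and> mul x x = 0 \<and> mul y y = 0 \<and> mul z z = 0 \<and>
     span {mul y z, mul x z, mul x y} = UNIV"

lemma linear_mul_left: "Vector_Spaces.linear scl scl (\<lambda>u. mul u v)"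
  by unfold_locales (simp_all add: mul_add_left mul_scale_left)

lemma linear_mul_right: "Vector_Spaces.linear scl scl (mul u)"
  by unfold_locales (simp_all add: mul_add_right mul_scale_right)

lemma mul_in_subspace_if_spanning:
  assumes "subspace I" and "span B = UNIV" and "\<And>a b. a \<in> B \<Longrightarrow> b \<in> B \<Longrightarrow> mul a b \<in> I"
  shows "mul u v \<in> I"
proof -
  have right: "mul a v \<in> I" if "a \<in> B" for a
  proof -
    have "v \<in> span B" using assms(2) by simp
    then show ?thesis
    proof (induction rule: span_induct_alt)
      case base
      show ?case
        using mul_scale_right[of a 0 0] subspace_0[OF assms(1)] by simp
    next
      case (step c b w)
      then show ?case
        using assms that
        by (simp add: mul_add_right mul_scale_right subspace_add subspace_scale)
    qed
  qed
  have "u \<in> span B" using assms(2) by simp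
  then show ?thesis
  proof (induction rule: span_induct_alt)
    case base
    show ?case
      using mul_scale_left[of 0 0 v] subspace_0[OF assms(1)] by simp
  next
    case (step c b w)
    then show ?case
      using assms(1) right
      by (simp add: mul_add_left mul_scale_left subspace_add subspace_scale)
  qed
qed

text \<open>
  In a commutative algebra, the products of distinct elements of a nil-basis span a subspace that
  contains all products, and so is an ideal. It is nonzero because a simple algebra has nonzero
  multiplication, so it is the whole algebra.
\<close>

lemma simple_nil_basis_gives_nil_spanning_triple:
  assumes simple and commutative and "dim UNIV = 3" and "nil_basis B"
  obtains x y z where "nil_spanning_triple x y z"
proof -
  have "independent B" and span_B: "span B = UNIV" and nil: "\<And>b. b \<in> B \<Longrightarrow> mul b b = 0"
    using assms(4) by (auto simp: nil_basis_def nil_element2_def)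
  then have "card B = 3"
    using dim_eq_card[of B UNIV] assms(3) by simp
  then obtain x y z where B: "B = {x, y, z}"
    by (auto simp: card_3_iff)
  let ?I = "span {mul y z, mul x z, mul x y}"
  have "mul u v = mul v u" for u v
    using assms(2) by (auto simp: commutative_def)
  then have table: "mul a b \<in> ?I" if "a \<in> B" "b \<in> B" for a b
    using that nil unfolding B by (auto intro: span_base span_zero)
  have products: "mul u v \<in> ?I" for u v
    using subspace_span span_B table by (rule mul_in_subspace_if_spanning)
  then have "ideal ?I"
    by (simp add: ideal_def)
  moreover have "?I \<noteq> {0}"
    using products assms(1) unfolding simple_def by blast
  ultimately have "?I = UNIV"
    using assms(1) unfolding simple_def by blast
  then have "nil_spanning_triple x y z"
    using span_B nil by (simp add: nil_spanning_triple_def B)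
  then show thesis by (rule that)
qed

end

text \<open>
  The map \<open>\<phi>\<close> matches the products and \<open>\<psi>\<close> matches the nil-bases. They can be chosen
  independently of each other, which is why the structure constants of the two algebras
  do not matter.
\<close>

lemma isotope_isomorphic_if_nil_spanning_triples:
  assumes A1: "nonassoc_algebra s1 m1" and A2: "nonassoc_algebra s2 m2"
    and dim1: "vector_space.dim s1 UNIV = 3" and dim2: "vector_space.dim s2 UNIV = 3"
    and comm1: "nonassoc_algebra.commutative m1" and comm2: "nonassoc_algebra.commutative m2"
    and nil1: "nonassoc_algebra.nil_spanning_triple s1 m1 x y z"
    and nil2: "nonassoc_algebra.nil_spanning_triple s2 m2 x' y' z'"
  obtains f where "invertible_operator s1 f"
    and "algebra_isomorphic s1 (isotope_mult m1 f f) s2 m2"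
proof -
  interpret A1: nonassoc_algebra s1 m1 by fact
  interpret A2: nonassoc_algebra s2 m2 by fact
  interpret p12: vector_space_pair s1 s2 ..
  interpret p21: vector_space_pair s2 s1 ..
  interpret p22: vector_space_pair s2 s2 ..
  note nil1' = nil1[unfolded A1.nil_spanning_triple_def]
  note nil2' = nil2[unfolded A2.nil_spanning_triple_def]
  have c1: "m1 u v = m1 v u" for u v
    using comm1 by (auto simp: A1.commutative_def)
  have c2: "m2 u v = m2 v u" for u v
    using comm2 by (auto simp: A2.commutative_def)
  obtain \<phi> where \<phi>: "Vector_Spaces.linear s1 s2 \<phi>" "bij \<phi>"
      "\<phi> (m1 y z) = m2 y' z'" "\<phi> (m1 x z) = m2 x' z'" "\<phi> (m1 x y) = m2 x' y'"
    using nil1' nil2' p12.linear_bijection_between_spanning_triples[OF dim1 _ dim2] by metis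
  obtain \<psi> where \<psi>: "Vector_Spaces.linear s2 s1 \<psi>" "bij \<psi>" "\<psi> x' = x" "\<psi> y' = y" "\<psi> z' = z"
    using nil1' nil2' p21.linear_bijection_between_spanning_triples[OF dim2 _ dim1] by metis
  interpret \<phi>: Vector_Spaces.linear s1 s2 \<phi> by (rule \<phi>)
  interpret \<psi>: Vector_Spaces.linear s2 s1 \<psi> by (rule \<psi>)
  have transport: "\<phi> (m1 (\<psi> s) (\<psi> t)) = m2 s t" for s t
  proof (rule p22.bilinear_eqI_on_spanning_set
      [where p = "\<lambda>s t. \<phi> (m1 (\<psi> s) (\<psi> t))" and q = m2 and B = "{x', y', z'}"])
    show "Vector_Spaces.linear s2 s2 (\<lambda>s. \<phi> (m1 (\<psi> s) (\<psi> t)))" for t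
      by unfold_locales
        (simp_all add: \<phi>.add \<psi>.add \<phi>.scale \<psi>.scale A1.mul_add_left A1.mul_scale_left)
    show "Vector_Spaces.linear s2 s2 (\<lambda>t. \<phi> (m1 (\<psi> s) (\<psi> t)))" for s
      by unfold_locales
        (simp_all add: \<phi>.add \<psi>.add \<phi>.scale \<psi>.scale A1.mul_add_right A1.mul_scale_right)
    show "\<phi> (m1 (\<psi> a) (\<psi> b)) = m2 a b" if "a \<in> {x', y', z'}" "b \<in> {x', y', z'}" for a b
      using that nil1' nil2' \<phi>(3-5) \<psi>(3-5) c1[of y x] c1[of z x] c1[of z y]
        c2[of y' x'] c2[of z' x'] c2[of z' y'] by (auto simp: \<phi>.zero)
  qed (use nil2' A2.linear_mul_left A2.linear_mul_right in auto)
  have "invertible_operator s1 (\<psi> \<circ> \<phi>)"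
    using \<phi>(1,2) \<psi>(1,2)
    by (auto simp: invertible_operator_def intro: Vector_Spaces.linear_compose bij_comp)
  moreover have "algebra_isomorphic s1 (isotope_mult m1 (\<psi> \<circ> \<phi>) (\<psi> \<circ> \<phi>)) s2 m2"
    unfolding algebra_isomorphic_def isotope_mult_def
    using \<phi>(1,2) transport by (intro exI[of _ \<phi>]) simp
  ultimately show thesis by (rule that)
qed

text \<open>
  By \<open>(a + bx + cy)\<^sup>2 = (a\<^sup>2 - 4bc) + (2ab - 4bc)x + (2ac - 4bc)y\<close>, a nil-element with
  \<open>b, c\<close> nonzero satisfies \<open>a = 2b = 2c\<close> when 2 is invertible, so up to a scalar
  \<open>2 + x + y\<close> is the only choice that can complete \<open>x, y\<close> to a nil-basis.
\<close>

lemma C_minus2_nil_spanning_triple: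
  assumes "(2 :: 'f::field) \<noteq> 0"
  shows "nonassoc_algebra.nil_spanning_triple ((*s) :: 'f \<Rightarrow> 'f ^ 3 \<Rightarrow> 'f ^ 3) C_minus2_mult
           (vector [0, 1, 0]) (vector [0, 0, 1]) (vector [2, 1, 1])"
proof -
  interpret C: nonassoc_algebra "(*s) :: 'f \<Rightarrow> 'f ^ 3 \<Rightarrow> 'f ^ 3" C_minus2_mult
    by (rule nonassoc_algebra_C_minus2)
  have powers_of_2: "(4 :: 'f) \<noteq> 0" "(8 :: 'f) \<noteq> 0"
    using power_not_zero[OF assms, of 2] power_not_zero[OF assms, of 3] by simp_all
  have span_eqI: "vec.span {a, b, c} = (UNIV :: ('f ^ 3) set)"
    if "\<And>v. \<exists>i j k. v = i *s a + j *s b + k *s c" for a b c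
  proof -
    have "i *s a + j *s b + k *s c \<in> vec.span {a, b, c}" for i j k
      by (intro vec.span_add vec.span_scale vec.span_base) auto
    then show ?thesis using that by (metis UNIV_eq_I)
  qed
  show ?thesis
    unfolding C.nil_spanning_triple_def
  proof (intro conjI)
    show "vec.span {vector [0, 1, 0], vector [0, 0, 1], vector [2, 1, 1 :: 'f] :: 'f ^ 3} = UNIV"
    proof (rule span_eqI)
      fix v :: "'f ^ 3"
      show "\<exists>i j k. v = i *s vector [0, 1, 0] + j *s vector [0, 0, 1] + k *s vector [2, 1, 1]"
        using assms
        by - (rule exI[of _ "v$2 - v$1 / 2"], rule exI[of _ "v$3 - v$1 / 2"],
          rule exI[of _ "v$1 / 2"], simp add: vec_eq_iff forall_3)
    qed
    \<comment> \<open>The products are \<open>-2(1 + x)\<close>, \<open>-2(1 + y)\<close> and \<open>-2(1 + x + y)\<close>; their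
      differences, divided by 2, yield \<open>x\<close> and \<open>y\<close>.\<close>
    show "vec.span {C_minus2_mult (vector [0, 0, 1]) (vector [2, 1, 1]),
            C_minus2_mult (vector [0, 1, 0]) (vector [2, 1, 1]),
            C_minus2_mult (vector [0, 1, 0]) (vector [0, 0, 1])} = (UNIV :: ('f ^ 3) set)"
    proof (rule span_eqI)
      fix v :: "'f ^ 3"
      show "\<exists>i j k. v = i *s C_minus2_mult (vector [0, 0, 1]) (vector [2, 1, 1]) +
              j *s C_minus2_mult (vector [0, 1, 0]) (vector [2, 1, 1]) +
              k *s C_minus2_mult (vector [0, 1, 0]) (vector [0, 0, 1])"
        using assms
        by - (rule exI[of _ "(v$3 - v$1) / 2"], rule exI[of _ "(v$2 - v$1) / 2"],
          rule exI[of _ "(v$1 - v$2 - v$3) / 2"],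
          simp add: powers_of_2 vec_eq_iff forall_3 C_minus2_mult_def Let_def field_simps)
    qed
  qed (simp_all add: vec_eq_iff forall_3 C_minus2_mult_def Let_def)
qed

theorem theorem2:
  fixes scl :: "'f::alg_closed_field \<Rightarrow> 'a::ab_group_add \<Rightarrow> 'a"
    and mul :: "'a \<Rightarrow> 'a \<Rightarrow> 'a"
  assumes "CHAR('f) \<noteq> 2"
    and "nonassoc_algebra scl mul"
    and "vector_space.dim scl (UNIV :: 'a set) = 3"
    and "nonassoc_algebra.simple scl mul"
    and "nonassoc_algebra.commutative mul"
    and "\<exists>B. nonassoc_algebra.nil_basis scl mul B"
  shows "\<exists>f g. invertible_operator scl f \<and> invertible_operator scl g \<and>
           proportional scl f g \<and>
           algebra_isomorphic scl (isotope_mult mul f g)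
             ((*s) :: 'f \<Rightarrow> 'f ^ 3 \<Rightarrow> 'f ^ 3) C_minus2_mult"
proof -
  interpret A: nonassoc_algebra scl mul by fact
  interpret C: nonassoc_algebra "(*s) :: 'f \<Rightarrow> 'f ^ 3 \<Rightarrow> 'f ^ 3" C_minus2_mult
    by (rule nonassoc_algebra_C_minus2)
  have "\<not> CHAR('f) dvd 2"
    using assms(1) by (metis CHAR_not_1' One_nat_def prime_nat_iff two_is_prime_nat)
  then have two: "(2 :: 'f) \<noteq> 0"
    using of_nat_eq_0_iff_char_dvd[where 'a = 'f, of 2] by simp
  have C_comm: "C.commutative"
    by (simp add: C.commutative_def C_minus2_mult_def Let_def algebra_simps)
  have C_dim: "vec.dim (UNIV :: ('f ^ 3) set) = 3"
    using vec_dim_card[where 'a = 'f and 'n = 3] by (simp del: vec.dim_UNIV)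
  obtain x y z where "A.nil_spanning_triple x y z"
    using assms(3-6) A.simple_nil_basis_gives_nil_spanning_triple by blast
  then obtain f where "invertible_operator scl f"
      and "algebra_isomorphic scl (isotope_mult mul f f) ((*s) :: 'f \<Rightarrow> 'f ^ 3 \<Rightarrow> 'f ^ 3) C_minus2_mult"
    using isotope_isomorphic_if_nil_spanning_triples[OF assms(2) nonassoc_algebra_C_minus2
        assms(3) C_dim assms(5) C_comm _ C_minus2_nil_spanning_triple[OF two]] by blast
  moreover have "proportional scl f f"
    unfolding proportional_def by (intro exI[of _ 1]) simp
  ultimately show ?thesis by blast
qed

end
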